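(* Let $\{P_\theta : \theta\in\mathbb{R}^p\}$ be an identifiable probability model with densities $f_\theta$ with respect to a measure $\lambda$, all almost surely positive, and suppose that its log likelihood is $$l(\theta) = U + Z'\theta - \tfrac12\,\theta' K\theta,\qquad \theta\in\mathbb{R}^p,$$ where $U$ is a random scalar, $Z$ is a random $p$-vector ($U$ and $Z$ being measurable functions of the data not depending on $\theta$), and $K$ is a constant (nonrandom) symmetric $p\times p$ matrix. Then (a) $K$ is positive definite; (b) for every $\theta\in\mathbb{R}^p$, the distribution of $Z$ for the parameter value $\theta$ (i.e. under $P_\theta$) is $\mathcal{N}(K\theta,K)$.
   Context: The data $X$ is a random element of a sample space; under parameter value $\theta$ it has density $f_\theta$ with respect to $\lambda$. The log likelihood of the model is the random function $l(\theta) = u(X) + \log f_\theta(X)$, where $u$ is any real-valued function on the sample space that does not depend on $\theta$. All densities are assumed almost surely positive, so all distributions in the family are mutually absolutely continuous. Identifiable means that $\theta_1\ne\theta_2$ implies $P_{\theta_1}\neq P_{\theta_2}$. A prime denotes transpose, and $\mathcal{N}(m,V)$ is the multivariate normal distribution with mean vector $m$ and variance matrix $V$. *)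

theory Defs
  imports "HOL-Probability.Probability"
begin

text \<open>The model: \<open>lam\<close> is the dominating measure on the sample space, and the data \<open>X\<close> is the
  identity on the sample space, so random quantities are functions on the space of \<open>lam\<close>.\<close>

definition model_dist :: "'a measure \<Rightarrow> ('t \<Rightarrow> 'a \<Rightarrow> real) \<Rightarrow> 't \<Rightarrow> 'a measure" where
  "model_dist lam f \<theta> = density lam (\<lambda>x. ennreal (f \<theta> x))"

text \<open>``Almost surely'' refers to every distribution of the family, not merely to the one with
  the density in question (for which positivity would be automatic). It is implied by positivity
  \<open>lam\<close>-almost everywhere.\<close>

definition probability_model :: "'a measure \<Rightarrow> ('t \<Rightarrow> 'a \<Rightarrow> real) \<Rightarrow> bool" where
  "probability_model lam f \<longleftrightarrow>
     (\<forall>\<theta>. f \<theta> \<in> borel_measurable lam \<and> (\<forall>x\<in>space lam. 0 \<le> f \<theta> x) \<and>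
          prob_space (model_dist lam f \<theta>)) \<and>
     (\<forall>\<theta> \<theta>'. AE x in model_dist lam f \<theta>'. 0 < f \<theta> x)"

definition identifiable :: "'a measure \<Rightarrow> ('t \<Rightarrow> 'a \<Rightarrow> real) \<Rightarrow> bool" where
  "identifiable lam f \<longleftrightarrow>
     (\<forall>\<theta>\<^sub>1 \<theta>\<^sub>2. \<theta>\<^sub>1 \<noteq> \<theta>\<^sub>2 \<longrightarrow> model_dist lam f \<theta>\<^sub>1 \<noteq> model_dist lam f \<theta>\<^sub>2)"

text \<open>The term \<open>u\<close> is an arbitrary function of the data alone. Where the density vanishes, the
  value of \<open>ln\<close> is a convention; this happens with probability zero in a
  \<open>probability_model\<close>.\<close>

definition log_likelihood :: "('a \<Rightarrow> real) \<Rightarrow> ('t \<Rightarrow> 'a \<Rightarrow> real) \<Rightarrow> 't \<Rightarrow> 'a \<Rightarrow> real" where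
  "log_likelihood u f \<theta> x = u x + ln (f \<theta> x)"

definition symmetric_matrix :: "real ^ 'n ^ 'n \<Rightarrow> bool" where
  "symmetric_matrix A \<longleftrightarrow> transpose A = A"

definition positive_definite :: "real ^ 'n ^ 'n \<Rightarrow> bool" where
  "positive_definite A \<longleftrightarrow> symmetric_matrix A \<and> (\<forall>x. x \<noteq> 0 \<longrightarrow> 0 < x \<bullet> (A *v x))"

definition std_multivariate_normal :: "(real ^ 'n) measure" where
  "std_multivariate_normal = density lborel (\<lambda>z. ennreal (\<Prod>i\<in>UNIV. std_normal_density (z $ i)))"

text \<open>\<open>M\<close> is the normal distribution with mean vector \<open>m\<close> and variance matrix \<open>V\<close> if it is the
  law of \<open>m + A z\<close> for a standard normal vector \<open>z\<close> and a square matrix \<open>A\<close> with \<open>A A' = V\<close>.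
  This also covers singular \<open>V\<close>; the law does not depend on the choice of \<open>A\<close>, and no such \<open>A\<close>
  exists unless \<open>V\<close> is symmetric positive semidefinite.\<close>

definition is_multivariate_normal :: "(real ^ 'n) measure \<Rightarrow> real ^ 'n \<Rightarrow> real ^ 'n ^ 'n \<Rightarrow> bool" where
  "is_multivariate_normal M m V \<longleftrightarrow>
     (\<exists>A :: real ^ 'n ^ 'n. A ** transpose A = V \<and>
        M = distr std_multivariate_normal borel (\<lambda>z. m + A *v z))"

end

theory Submission
  imports Defs "HOL-Complex_Analysis.Cauchy_Integral_Formula"
begin

text \<open>
  Write \<open>q(s) = s' K s\<close>. Dividing the likelihoods at \<open>\<theta> + s\<close> and at \<open>\<theta>\<close> cancels \<open>u\<close> and \<open>U\<close> and
  leaves \<open>f (\<theta> + s) = f \<theta> * exp (s' Z - s' K \<theta> - q(s) / 2)\<close> almost everywhere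
  (\<open>density_exponential_tilt\<close>). Since \<open>f (\<theta> + s)\<close> integrates to one, integrating this identity
  computes the moment generating function of \<open>Z\<close> under \<open>\<theta>\<close> as \<open>exp (s' K \<theta> + q(s) / 2)\<close> for every
  \<open>s\<close> (\<open>statistic_mgf\<close>). Both claims follow from this formula.

  Positive definiteness: at \<open>\<theta> = 0\<close> the mean of \<open>cosh (s' Z)\<close> is \<open>exp (q(s) / 2)\<close>. If
  \<open>q(s) \<le> 0\<close>, then this mean is at most one; but \<open>cosh \<ge> 1\<close> with equality only at zero, so
  \<open>s' Z = 0\<close> almost surely and \<open>q(s) = 0\<close>. Then the densities at \<open>s\<close> and at \<open>0\<close> agree, and
  identifiability gives \<open>s = 0\<close> (\<open>information_positive_definite\<close>).

  Normality: a positive definite \<open>K\<close> factors as \<open>A A'\<close> (\<open>positive_definite_factorization\<close>), and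
  \<open>K \<theta> + A z\<close> with \<open>z\<close> standard normal has the same moment generating function
  (\<open>multivariate_normal_mgf\<close>). A moment generating function that is finite everywhere determines
  the measure (\<open>measure_eqI_mgf\<close>). On the line this is because the exponential generating
  series of the moments gives both the moment generating function and the characteristic function; in
  several dimensions the coordinates are handled one after the other, the exponential in each being
  exchanged for the indicator of a Borel set.
\<close>

section \<open>Moment generating functions on the real line\<close>

text \<open>The partial sums of the exponential series have a common integrable majorant, which allows the
  series to be integrated term by term.\<close>

lemma norm_exp_partial_sum_le:
  fixes y :: "'b :: {real_normed_field, banach}"
  shows "norm (\<Sum>k<n. y ^ k /\<^sub>R fact k) \<le> exp (norm y)"
proof -
  have "norm (\<Sum>k<n. y ^ k /\<^sub>R fact k) \<le> (\<Sum>k<n. norm y ^ k /\<^sub>R fact k)"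
    by (rule sum_norm_le) (simp add: norm_power)
  also have "\<dots> \<le> (\<Sum>k. norm y ^ k /\<^sub>R fact k)"
    by (rule sum_le_suminf) (use summable_exp_generic[of "norm y"] in simp_all)
  finally show ?thesis
    by (simp add: exp_def)
qed

lemma norm_exp_term_le:
  fixes y :: "'b :: {real_normed_field, banach}"
  shows "norm (y ^ k /\<^sub>R fact k) \<le> exp (norm y)"
proof -
  have "norm (y ^ k /\<^sub>R fact k) = (\<Sum>j\<in>{k}. norm y ^ j /\<^sub>R fact j)"
    by (simp add: norm_power)
  also have "\<dots> \<le> (\<Sum>j. norm y ^ j /\<^sub>R fact j)"
    by (rule sum_le_suminf) (use summable_exp_generic[of "norm y"] in simp_all)
  finally show ?thesis
    by (simp add: exp_def)
qed

text \<open>Since \<open>exp \<bar>r x\<bar> \<le> exp (r x) + exp (- r x)\<close>, a moment generating function that is finite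
  everywhere dominates the exponential series. The argument \<open>z\<close> ranges over a general field so that
  one lemma covers real \<open>z\<close> (the moment generating function) and imaginary \<open>z\<close> (the characteristic
  function).\<close>

lemma mgf_power_series:
  fixes M :: "real measure" and z :: "'b :: {real_normed_field, banach, second_countable_topology}"
  assumes [measurable_cong]: "sets M = sets borel"
    and mgf: "\<And>s. integrable M (\<lambda>x. exp (s * x))"
  shows "(\<lambda>k. of_real ((\<integral>x. x ^ k \<partial>M) / fact k) * z ^ k) sums (\<integral>x. exp (of_real x * z) \<partial>M)"
proof -
  have bound: "exp (norm (of_real x * w)) \<le> exp (norm w * x) + exp (- norm w * x)"
    for x and w :: 'b
    by (cases "x \<ge> 0") (auto simp: norm_mult mult.commute)
  have dominating: "integrable M (\<lambda>x. exp (norm w * x) + exp (- norm w * x))" for w :: 'b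
    by (intro Bochner_Integration.integrable_add mgf)
  have term_int: "integrable M (\<lambda>x. (of_real x * w) ^ k /\<^sub>R fact k)" for k and w :: 'b
    by (rule Bochner_Integration.integrable_bound[OF dominating[of w]])
       (measurable, auto simp del: norm_scaleR intro!: AE_I2 order_trans[OF norm_exp_term_le order_trans[OF bound]])
  have pow_int: "integrable M (\<lambda>x. x ^ k)" for k
  proof -
    have bound_pow: "\<bar>x ^ k\<bar> \<le> fact k * (exp (1 * x) + exp (-1 * x))" for x :: real
    proof -
      have "\<bar>x ^ k\<bar> = fact k * norm (x ^ k /\<^sub>R fact k)"
        by (simp add: abs_mult)
      also have "\<dots> \<le> fact k * (exp (1 * x) + exp (-1 * x))"
        by (intro mult_left_mono order_trans[OF norm_exp_term_le]) (auto simp: abs_if)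
      finally show ?thesis .
    qed
    have "integrable M (\<lambda>x. fact k * (exp (1 * x) + exp (-1 * x)))"
      by (intro integrable_mult_right Bochner_Integration.integrable_add mgf)
    then show ?thesis
      by (rule Bochner_Integration.integrable_bound) (measurable, intro AE_I2, use bound_pow in force)
  qed
  have "(\<lambda>n. \<integral>x. (\<Sum>k<n. (of_real x * z) ^ k /\<^sub>R fact k) \<partial>M)
          \<longlonglongrightarrow> (\<integral>x. exp (of_real x * z) \<partial>M)"
  proof (rule integral_dominated_convergence)
    show "integrable M (\<lambda>x. exp (norm z * x) + exp (- norm z * x))"
      by (rule dominating)
    show "AE x in M. (\<lambda>n. \<Sum>k<n. (of_real x * z) ^ k /\<^sub>R fact k) \<longlonglongrightarrow> exp (of_real x * z)"
      using exp_converges[of "of_real _ * z"] by (auto simp: sums_def)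
    show "AE x in M. norm (\<Sum>k<n. (of_real x * z) ^ k /\<^sub>R fact k)
            \<le> exp (norm z * x) + exp (- norm z * x)" for n
      using order_trans[OF norm_exp_partial_sum_le bound] by (intro AE_I2)
    show "(\<lambda>x. exp (of_real x * z)) \<in> borel_measurable M"
      by measurable
  qed auto
  moreover have "(\<integral>x. (\<Sum>k<n. (of_real x * z) ^ k /\<^sub>R fact k) \<partial>M)
      = (\<Sum>k<n. of_real ((\<integral>x. x ^ k \<partial>M) / fact k) * z ^ k)" for n
  proof -
    have "(\<integral>x. (of_real x * z) ^ k /\<^sub>R fact k \<partial>M) = of_real ((\<integral>x. x ^ k \<partial>M) / fact k) * z ^ k" for k
    proof -
      have "(\<integral>x. (of_real x * z) ^ k /\<^sub>R fact k \<partial>M)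
          = (\<integral>x. x ^ k *\<^sub>R (z ^ k /\<^sub>R fact k) \<partial>M)"
        by (simp add: power_mult_distrib scaleR_conv_of_real mult_ac)
      also have "\<dots> = (\<integral>x. x ^ k \<partial>M) *\<^sub>R (z ^ k /\<^sub>R fact k)"
        using pow_int by (intro integral_scaleR_left)
      finally show ?thesis
        by (simp add: scaleR_conv_of_real field_simps)
    qed
    then show ?thesis
      by (simp add: Bochner_Integration.integral_sum term_int del: scaleR_conv_of_real)
  qed
  ultimately show ?thesis
    by (simp add: sums_def)
qed

text \<open>The zeros of a power series with a nonzero coefficient of positive index are isolated, and the
  coefficient of index zero is the value at the origin.\<close>

lemma power_series_zero_coeffs:
  fixes a :: "nat \<Rightarrow> 'b :: {real_normed_field, banach}"
  assumes "\<And>x. (\<lambda>k. a k * x ^ k) sums 0"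
  shows "a k = 0"
proof (cases "k = 0")
  case True
  then show ?thesis
    using assms[of 0] powser_sums_zero[of a] sums_unique2 by blast
next
  case False
  show ?thesis
  proof (rule ccontr)
    assume "a k \<noteq> 0"
    then obtain s :: real where "0 < s"
      and nz: "\<And>z::'b. z \<in> cball 0 s - {0} \<Longrightarrow> (0::'b) \<noteq> 0"
      using powser_0_nonzero[of 1 0 a "\<lambda>_. 0" k] assms False by auto
    then show False
      using nz[of "of_real s"] by auto
  qed
qed

text \<open>The moments are read off from the power series at real arguments and put back into it at
  imaginary ones. So the characteristic functions agree, and Levy's uniqueness theorem applies.\<close>

lemma real_distribution_eqI_mgf:
  assumes "real_distribution M" "real_distribution N"
    and M: "\<And>s. integrable M (\<lambda>x. exp (s * x))"
    and N: "\<And>s. integrable N (\<lambda>x. exp (s * x))"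
    and eq: "\<And>s. (\<integral>x. exp (s * x) \<partial>M) = (\<integral>x. exp (s * x) \<partial>N)"
  shows "M = N"
proof -
  interpret M: real_distribution M by fact
  interpret N: real_distribution N by fact
  note series = mgf_power_series[OF M.events_eq_borel M] mgf_power_series[OF N.events_eq_borel N]
  have coeffs: "(\<integral>x. x ^ k \<partial>M) / fact k = (\<integral>x. x ^ k \<partial>N) / fact k" for k
  proof -
    have "(\<lambda>k. ((\<integral>x. x ^ k \<partial>M) / fact k - (\<integral>x. x ^ k \<partial>N) / fact k) * s ^ k) sums 0" for s :: real
      using sums_diff[OF series(1)[of s] series(2)[of s]] eq[of s] by (simp add: algebra_simps)
    from power_series_zero_coeffs[OF this, of k] show ?thesis
      by simp
  qed
  have "char M t = char N t" for t
  proof -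
    have "(\<integral>x. exp (of_real x * (\<i> * of_real t)) \<partial>M) = (\<integral>x. exp (of_real x * (\<i> * of_real t)) \<partial>N)"
      using series[of "\<i> * of_real t"] unfolding coeffs by (rule sums_unique2)
    then show ?thesis
      by (simp add: char_def mult_ac)
  qed
  then show ?thesis
    using Levy_uniqueness assms by blast
qed

text \<open>Finite measures that need not have mass one are required below, where a coordinate is studied
  under a measure weighted by a function of the other coordinates. The common mass is the value of
  both moment generating functions at zero; unless it is zero, division by it
  leads back to probability measures.\<close>

lemma real_measure_eqI_mgf:
  fixes M N :: "real measure"
  assumes [measurable_cong]: "sets M = sets borel" "sets N = sets borel"
    and eq: "\<And>s. (\<integral>\<^sup>+x. exp (s * x) \<partial>M) = (\<integral>\<^sup>+x. exp (s * x) \<partial>N)"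
    and fin: "\<And>s. (\<integral>\<^sup>+x. exp (s * x) \<partial>M) < \<infinity>"
  shows "M = N"
proof -
  define c where "c = emeasure M UNIV"
  have space: "space M = UNIV" "space N = UNIV"
    using assms(1,2) by (simp_all add: sets_eq_imp_space_eq)
  have mass: "emeasure M UNIV = c" "emeasure N UNIV = c" "c \<noteq> \<infinity>"
    using eq[of 0] fin[of 0] space by (simp_all add: c_def)
  show ?thesis
  proof (cases "c = 0")
    case True
    have "emeasure L A = 0" if "emeasure L UNIV = c" "sets L = sets borel" for L :: "real measure" and A
      using emeasure_mono[of A UNIV L] that True by simp
    then show ?thesis
      using mass by (intro measure_eqI) (simp_all add: assms(1,2))
  next
    case False
    define normalised where "normalised L = density L (\<lambda>_. 1 / c)" for L :: "real measure"
    have normalised: "real_distribution (normalised L) \<and> integrable (normalised L) (\<lambda>x. exp (s * x)) \<and>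
        (\<integral>x. exp (s * x) \<partial>normalised L) = enn2real (1 / c * (\<integral>\<^sup>+x. exp (s * x) \<partial>M))"
      if [measurable_cong]: "sets L = sets borel" and "emeasure L UNIV = c" 
        and L: "\<And>s. (\<integral>\<^sup>+x. exp (s * x) \<partial>L) = (\<integral>\<^sup>+x. exp (s * x) \<partial>M)" for L s
    proof -
      have "space L = UNIV"
        using that(1) by (simp add: sets_eq_imp_space_eq)
      then have "emeasure (normalised L) (space (normalised L)) = 1"
        using that False mass
        by (simp add: normalised_def emeasure_density_const ennreal_divide_times ennreal_divide_self less_top)
      then have "prob_space (normalised L)"
        by (rule prob_spaceI)
      then have "real_distribution (normalised L)"
        using that(1) by (simp add: real_distribution_def real_distribution_axioms_def normalised_def)
      moreover have nn: "(\<integral>\<^sup>+x. exp (s * x) \<partial>normalised L) = 1 / c * (\<integral>\<^sup>+x. exp (s * x) \<partial>M)"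
        by (simp add: normalised_def nn_integral_density nn_integral_cmult L)
      moreover have "\<dots> < \<infinity>"
        using fin[of s] False
        by (simp add: ennreal_mult_eq_top_iff ennreal_divide_eq_top_iff less_top[symmetric])
      moreover have "(\<lambda>x. exp (s * x)) \<in> borel_measurable (normalised L)"
        by (simp add: normalised_def)
      ultimately show ?thesis
        by (auto simp: integrable_iff_bounded integral_eq_nn_integral)
    qed
    have "normalised M = normalised N"
      using normalised[of M] normalised[of N] assms(1,2) mass eq
      by (intro real_distribution_eqI_mgf) auto
    have "emeasure M A = emeasure N A" if "A \<in> sets borel" for A
    proof -
      have "1 / c * emeasure M A = 1 / c * emeasure N A"
        using arg_cong[OF \<open>normalised M = normalised N\<close>, of "\<lambda>L. emeasure L A"] that assms(1,2)
        by (simp add: normalised_def emeasure_density_const)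
      then have "c * (1 / c) * emeasure M A = c * (1 / c) * emeasure N A"
        by (simp add: mult.assoc)
      moreover have "c * (1 / c) = 1"
        using False mass by (simp add: ennreal_times_divide ennreal_divide_self top.not_eq_extremum)
      ultimately show ?thesis
        by simp
    qed
    then show ?thesis
      using assms(1,2) by (intro measure_eqI) simp_all
  qed
qed

section \<open>Moment generating functions in several dimensions\<close>

text \<open>Suppose the integrals of \<open>\<Prod>i\<in>J. 1\<^sub>A\<^sub>i(x\<^sub>i)\<close> times \<open>exp (\<Sum>i\<notin>J. s\<^sub>i x\<^sub>i)\<close> agree for all
  \<open>s\<close>. For \<open>j \<notin> J\<close> leave the factor \<open>exp (s\<^sub>j x\<^sub>j)\<close> out of the weight and let \<open>s\<^sub>j\<close> vary: the
  weighted laws of the \<open>j\<close>-th coordinate have the same moment generating function, so they are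
  equal and give the same mass to \<open>A\<^sub>j\<close>. Thus \<open>j\<close> can be added to \<open>J\<close>. When \<open>J\<close> contains all
  coordinates, the integrals are the measures of boxes.\<close>

lemma measure_eqI_mgf:
  fixes M N :: "(real ^ 'n) measure"
  assumes [measurable_cong]: "sets M = sets borel" "sets N = sets borel"
    and eq: "\<And>s. (\<integral>\<^sup>+x. exp (s \<bullet> x) \<partial>M) = (\<integral>\<^sup>+x. exp (s \<bullet> x) \<partial>N)"
    and fin: "\<And>s. (\<integral>\<^sup>+x. exp (s \<bullet> x) \<partial>M) < \<infinity>"
  shows "M = N"
proof -
  have key: "(\<integral>\<^sup>+x. (\<Prod>i\<in>J. indicator (A i) (x $ i)) * ennreal (exp (\<Sum>i\<in>- J. s i * x $ i)) \<partial>M)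
        = (\<integral>\<^sup>+x. (\<Prod>i\<in>J. indicator (A i) (x $ i)) * ennreal (exp (\<Sum>i\<in>- J. s i * x $ i)) \<partial>N)
      \<and> (\<integral>\<^sup>+x. (\<Prod>i\<in>J. indicator (A i) (x $ i)) * ennreal (exp (\<Sum>i\<in>- J. s i * x $ i)) \<partial>M) < \<infinity>"
    if [measurable]: "\<And>i. A i \<in> sets borel" for J and A :: "'n \<Rightarrow> real set" and s :: "'n \<Rightarrow> real"
    using finite[of J]
  proof (induction J arbitrary: s rule: finite_induct)
    case empty
    have "(\<Sum>i\<in>UNIV. s i * x $ i) = (\<chi> i. s i) \<bullet> x" for x
      by (simp add: inner_vec_def)
    then show ?case
      using eq fin by simp
  next
    case (insert j J)
    define h :: "real ^ 'n \<Rightarrow> ennreal" where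
      "h x = (\<Prod>i\<in>J. indicator (A i) (x $ i)) * ennreal (exp (\<Sum>i\<in>- insert j J. s i * x $ i))" for x
    have [measurable]: "h \<in> borel_measurable borel"
      unfolding h_def by measurable
    define image where "image L = distr (density L h) borel (\<lambda>x. x $ j)" for L
    have image_nn: "(\<integral>\<^sup>+y. g y \<partial>image L) = (\<integral>\<^sup>+x. h x * g (x $ j) \<partial>L)"
      if [measurable_cong]: "sets L = sets borel" and [measurable]: "g \<in> borel_measurable borel" for L g
      by (simp add: image_def nn_integral_distr nn_integral_density)
    have split: "- J = insert j (- insert j J)"
      using insert by auto
    have tilt: "h x * ennreal (exp (t * x $ j)) = (\<Prod>i\<in>J. indicator (A i) (x $ i)) *
        ennreal (exp (\<Sum>i\<in>- J. (s(j := t)) i * x $ i))" for x t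
    proof -
      have "(\<Sum>i\<in>- J. (s(j := t)) i * x $ i) = t * x $ j + (\<Sum>i\<in>- insert j J. s i * x $ i)"
        unfolding split by (subst sum.insert) (auto intro!: sum.cong)
      then show ?thesis
        by (simp only: h_def exp_add) (simp add: ennreal_mult mult_ac)
    qed
    have image_mgf: "(\<integral>\<^sup>+y. ennreal (exp (t * y)) \<partial>image L) = (\<integral>\<^sup>+x. (\<Prod>i\<in>J. indicator (A i) (x $ i)) *
        ennreal (exp (\<Sum>i\<in>- J. (s(j := t)) i * x $ i)) \<partial>L)"
      if "sets L = sets borel" for L t
      by (subst image_nn[OF that]) (measurable, simp only: tilt)
    have "image M = image N"
    proof (rule real_measure_eqI_mgf)
      show "sets (image M) = sets borel" "sets (image N) = sets borel"
        by (simp_all add: image_def)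
      fix t
      show "(\<integral>\<^sup>+y. exp (t * y) \<partial>image M) = (\<integral>\<^sup>+y. exp (t * y) \<partial>image N)"
        "(\<integral>\<^sup>+y. exp (t * y) \<partial>image M) < \<infinity>"
        unfolding image_mgf[OF assms(1)] image_mgf[OF assms(2)]
        using insert.IH[of "s(j := t)"] by blast+
    qed
    have restrict: "(\<Prod>i\<in>insert j J. indicator (A i) (x $ i)) * ennreal (exp (\<Sum>i\<in>- insert j J. s i * x $ i))
        = h x * indicator (A j) (x $ j)" for x
      using insert by (simp add: h_def mult_ac)
    \<comment> \<open>Finiteness is carried along by comparing the indicator with \<open>exp 0\<close>.\<close>
    have "(\<integral>\<^sup>+y. indicator (A j) y \<partial>image M) \<le> (\<integral>\<^sup>+y. ennreal (exp (0 * y)) \<partial>image M)"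
      by (intro nn_integral_mono) (auto simp: indicator_def)
    also have "\<dots> < \<infinity>"
      unfolding image_mgf[OF assms(1)] using insert.IH[of "s(j := 0)"] by blast
    finally have "(\<integral>\<^sup>+y. indicator (A j) y \<partial>image M) < \<infinity>" .
    then show ?case
      unfolding restrict using \<open>image M = image N\<close>
      by (simp only: image_nn[OF assms(1), symmetric] image_nn[OF assms(2), symmetric]
         borel_measurable_indicator that)
  qed
  show ?thesis
  proof (rule measure_eqI_generator_eq)
    let ?E = "range (\<lambda>(a, b). box a b :: (real ^ 'n) set)"
    let ?A = "\<lambda>n::nat. box (- (real n *\<^sub>R One)) (real n *\<^sub>R One) :: (real ^ 'n) set"
    show "Int_stable ?E"
      by (auto simp: Int_stable_def box_Int_box)
    show "?E \<subseteq> Pow UNIV" "sets M = sigma_sets UNIV ?E" "sets N = sigma_sets UNIV ?E"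
      by (simp_all add: borel_eq_box assms(1,2))
    show "range ?A \<subseteq> ?E" "(\<Union>i. ?A i) = UNIV"
      unfolding UN_box_eq_UNIV by auto
    have "emeasure M UNIV < \<infinity>"
      using fin[of 0] sets_eq_imp_space_eq[OF assms(1)] by simp
    then show "emeasure M (?A i) \<noteq> \<infinity>" for i
      using emeasure_mono[of "?A i" UNIV M] assms(1) by (auto simp: top_unique)
    fix X :: "(real ^ 'n) set"
    assume "X \<in> ?E"
    then obtain a b where X: "X = box a b"
      by auto
    have "indicator X x = (\<Prod>i\<in>UNIV. indicator {a $ i <..< b $ i} (x $ i) :: ennreal)" for x
      by (auto simp: X mem_box_cart indicator_def prod_zero_iff)
    then show "emeasure M X = emeasure N X"
      using key[of "\<lambda>i. {a $ i <..< b $ i}" UNIV] 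
      by (simp add: X assms(1,2) flip: nn_integral_indicator)
  qed
qed

section \<open>The moment generating function of the normal distribution\<close>

text \<open>Completing the square: an exponential tilt shifts the mean of a normal density.\<close>

lemma normal_density_tilt:
  "std_normal_density x * exp (t * x) = exp (t\<^sup>2 / 2) * normal_density t 1 x"
  by (simp add: normal_density_def power2_eq_square field_simps flip: exp_add)

lemma std_normal_mgf:
  "(\<integral>\<^sup>+x. std_normal_density x * exp (t * x) \<partial>lborel) = exp (t\<^sup>2 / 2)"
proof -
  have "(\<integral>\<^sup>+x. normal_density t 1 x \<partial>lborel) = 1"
    by (subst nn_integral_eq_integral) simp_all
  then show ?thesis
    by (simp add: normal_density_tilt ennreal_mult nn_integral_cmult)
qed

lemma prod_Basis_cart:
  fixes z :: "real ^ 'n"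
  shows "(\<Prod>b\<in>Basis. g (z \<bullet> b)) = (\<Prod>i\<in>UNIV. g (z $ i))"
proof -
  have "Basis = range (\<lambda>i. axis i 1 :: real ^ 'n)"
    by (auto simp: Basis_vec_def)
  moreover have "inj (\<lambda>i. axis i 1 :: real ^ 'n)"
    by (auto simp: inj_def axis_eq_axis)
  ultimately show ?thesis
    by (subst \<open>Basis = _\<close>, subst prod.reindex) (simp_all add: inner_axis)
qed

lemma std_multivariate_normal_mgf:
  fixes t :: "real ^ 'n"
  shows "(\<integral>\<^sup>+z. exp (t \<bullet> z) \<partial>std_multivariate_normal) = exp ((t \<bullet> t) / 2)"
proof -
  have "(\<integral>\<^sup>+z. exp (t \<bullet> z) \<partial>std_multivariate_normal)
      = (\<integral>\<^sup>+z. (\<Prod>i\<in>UNIV. std_normal_density (z $ i)) * exp (t \<bullet> z) \<partial>lborel)"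
    by (simp add: std_multivariate_normal_def nn_integral_density ennreal_mult prod_nonneg)
  also have "\<dots> = (\<integral>\<^sup>+z. (\<Prod>b\<in>Basis. ennreal (std_normal_density (z \<bullet> b) * exp ((t \<bullet> b) * (z \<bullet> b)))) \<partial>lborel)"
  proof (rule nn_integral_cong)
    fix z :: "real ^ 'n"
    have "exp (t \<bullet> z) = (\<Prod>b\<in>Basis. exp ((t \<bullet> b) * (z \<bullet> b)))"
      by (subst euclidean_inner) (simp add: exp_sum)
    then have "(\<Prod>i\<in>UNIV. std_normal_density (z $ i)) * exp (t \<bullet> z)
        = (\<Prod>b\<in>Basis. std_normal_density (z \<bullet> b) * exp ((t \<bullet> b) * (z \<bullet> b)))"
      by (simp add: prod.distrib prod_Basis_cart)
    then show "ennreal ((\<Prod>i\<in>UNIV. std_normal_density (z $ i)) * exp (t \<bullet> z))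
        = (\<Prod>b\<in>Basis. ennreal (std_normal_density (z \<bullet> b) * exp ((t \<bullet> b) * (z \<bullet> b))))"
      by (simp add: prod_ennreal)
  qed
  also have "\<dots> = (\<Prod>b\<in>Basis. \<integral>\<^sup>+x. std_normal_density x * exp ((t \<bullet> b) * x) \<partial>lborel)"
    by (rule nn_integral_lborel_prod) auto
  also have "\<dots> = exp (\<Sum>b\<in>Basis. (t \<bullet> b)\<^sup>2 / 2)"
    by (simp only: std_normal_mgf) (simp add: prod_ennreal exp_sum)
  also have "(\<Sum>b\<in>Basis. (t \<bullet> b)\<^sup>2 / 2) = (t \<bullet> t) / 2"
    by (subst (2) euclidean_inner) (simp add: sum_divide_distrib power2_eq_square)
  finally show ?thesis .
qed

lemma multivariate_normal_mgf:
  fixes A :: "real ^ 'n ^ 'n"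
  shows "(\<integral>\<^sup>+x. exp (s \<bullet> x) \<partial>distr std_multivariate_normal borel (\<lambda>z. m + A *v z))
       = exp (s \<bullet> m + (s \<bullet> ((A ** transpose A) *v s)) / 2)"
proof -
  have [measurable_cong]: "sets std_multivariate_normal = sets borel"
    by (simp add: std_multivariate_normal_def)
  have [measurable]: "(\<lambda>z. m + A *v z) \<in> borel_measurable borel"
    by (intro borel_measurable_continuous_onI continuous_intros)
  have "(\<integral>\<^sup>+x. exp (s \<bullet> x) \<partial>distr std_multivariate_normal borel (\<lambda>z. m + A *v z))
      = (\<integral>\<^sup>+z. ennreal (exp (s \<bullet> m)) * exp ((transpose A *v s) \<bullet> z) \<partial>std_multivariate_normal)"
    by (simp add: nn_integral_distr inner_add_right exp_add ennreal_mult flip: dot_lmul_matrix)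
  also have "\<dots> = exp (s \<bullet> m) * exp (((transpose A *v s) \<bullet> (transpose A *v s)) / 2)"
    by (simp add: nn_integral_cmult std_multivariate_normal_mgf ennreal_mult)
  also have "(transpose A *v s) \<bullet> (transpose A *v s) = s \<bullet> ((A ** transpose A) *v s)"
    by (simp add: dot_lmul_matrix flip: matrix_vector_mul_assoc)
  finally show ?thesis
    by (simp add: exp_add)
qed

section \<open>Factorization of positive definite matrices\<close>

text \<open>Gram--Schmidt for the inner product \<open>x' K y\<close>. As long as fewer vectors than the dimension have
  been chosen, some \<open>w \<noteq> 0\<close> is orthogonal in the ordinary sense to all \<open>K b\<^sub>i\<close>, and \<open>w\<close> can be
  normalised because \<open>w' K w > 0\<close>.\<close>

lemma positive_definite_orthonormal_family:
  fixes K :: "real ^ 'n ^ 'n"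
  assumes "positive_definite K"
  obtains b :: "'n \<Rightarrow> real ^ 'n" where "\<And>i j. b i \<bullet> (K *v b j) = (if i = j then 1 else 0)"
proof -
  have sym: "x \<bullet> (K *v y) = y \<bullet> (K *v x)" for x y
    using assms
    by (metis positive_definite_def symmetric_matrix_def dot_lmul_matrix inner_commute transpose_matrix_vector)
  have "\<exists>b :: 'n \<Rightarrow> real ^ 'n. \<forall>i\<in>T. \<forall>j\<in>T. b i \<bullet> (K *v b j) = (if i = j then 1 else 0)" for T
    using finite[of T]
  proof (induction T rule: finite_induct)
    case empty
    show ?case by simp
  next
    case (insert k T)
    then obtain b :: "'n \<Rightarrow> real ^ 'n"
      where b: "\<And>i j. i \<in> T \<Longrightarrow> j \<in> T \<Longrightarrow> b i \<bullet> (K *v b j) = (if i = j then 1 else 0)"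
      by auto
    let ?S = "(\<lambda>i. K *v b i) ` T"
    have "dim ?S \<le> card ?S"
      by (intro dim_le_card' ) simp
    also have "\<dots> \<le> card T"
      by (rule card_image_le) simp
    also have "\<dots> < CARD('n)"
      using insert by (intro psubset_card_mono) auto
    finally obtain w where "w \<noteq> 0" and orth: "\<And>y. y \<in> span ?S \<Longrightarrow> orthogonal w y"
      using orthogonal_to_subspace_exists[of ?S] by auto
    define q where "q = w \<bullet> (K *v w)"
    have "q > 0"
      using assms \<open>w \<noteq> 0\<close> by (simp add: positive_definite_def q_def)
    define v where "v = w /\<^sub>R sqrt q"
    have "v \<bullet> (K *v v) = 1"
      using \<open>q > 0\<close> by (simp add: v_def matrix_vector_mult_scaleR field_simps flip: q_def)
    moreover have "v \<bullet> (K *v b i) = 0" if "i \<in> T" for i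
      using orth[of "K *v b i"] that by (simp add: v_def orthogonal_def span_base)
    ultimately show ?case
      using b sym insert
      by (intro exI[of _ "b(k := v)"]) auto
  qed
  from this[of UNIV] show thesis
    using that by auto
qed

text \<open>If the rows of \<open>B\<close> are orthonormal for \<open>K\<close>, then \<open>B K B' = I\<close>, so \<open>A = B\<^sup>-\<^sup>1\<close> satisfies
  \<open>A A' = K\<close>.\<close>

lemma positive_definite_factorization:
  fixes K :: "real ^ 'n ^ 'n"
  assumes "positive_definite K"
  obtains A :: "real ^ 'n ^ 'n" where "A ** transpose A = K"
proof -
  obtain b :: "'n \<Rightarrow> real ^ 'n" where b: "\<And>i j. b i \<bullet> (K *v b j) = (if i = j then 1 else 0)"
    using positive_definite_orthonormal_family[OF assms] by blast
  define B where "B = (\<chi> i. b i)"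
  have "(B ** K ** transpose B) $ i $ j = b i \<bullet> (K *v b j)" for i j
    by (simp add: B_def matrix_matrix_mult_def matrix_vector_mult_def transpose_def inner_vec_def
        sum_distrib_left sum_distrib_right mult_ac) (rule sum.swap)
  then have BKB: "B ** K ** transpose B = mat 1"
    by (simp add: vec_eq_iff b mat_def)
  then have "B ** (K ** transpose B) = mat 1"
    by (simp add: matrix_mul_assoc)
  then obtain A :: "real ^ 'n ^ 'n" where AB: "A ** B = mat 1"
    by (metis matrix_left_right_inverse)
  then have "transpose B ** transpose A = mat 1"
    by (metis matrix_transpose_mul transpose_mat)
  then have "A ** transpose A = A ** (B ** K ** transpose B) ** transpose A"
    by (simp add: BKB)
  also have "\<dots> = (A ** B) ** K ** (transpose B ** transpose A)"
    by (simp add: matrix_mul_assoc)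
  also have "\<dots> = K"
    by (simp add: AB \<open>transpose B ** transpose A = mat 1\<close>)
  finally show thesis
    by (rule that)
qed

section \<open>Models with a quadratic log likelihood\<close>

lemma quadratic_form_add:
  fixes K :: "real ^ 'n ^ 'n"
  assumes "symmetric_matrix K"
  shows "(a + s) \<bullet> (K *v (a + s)) = a \<bullet> (K *v a) + 2 * (s \<bullet> (K *v a)) + s \<bullet> (K *v s)"
proof -
  have "a \<bullet> (K *v s) = s \<bullet> (K *v a)"
    using assms
    by (metis symmetric_matrix_def dot_lmul_matrix inner_commute transpose_matrix_vector)
  then show ?thesis
    by (simp add: matrix_vector_right_distrib inner_add_left inner_add_right)
qed

lemma AE_model_distD:
  assumes "f \<theta> \<in> borel_measurable lam" and "AE x in model_dist lam f \<theta>. P x"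
  shows "AE x in lam. 0 < f \<theta> x \<longrightarrow> P x"
  using assms unfolding model_dist_def by (subst (asm) AE_density) simp_all

text \<open>The identity holds \<open>lam\<close>-almost everywhere and not only under the model distributions:
  since these are mutually absolutely continuous, both sides vanish together outside the set where
  the logarithms are meaningful.\<close>

lemma density_exponential_tilt:
  fixes f :: "real ^ 'p \<Rightarrow> 'a \<Rightarrow> real"
  assumes model: "probability_model lam f" and sym: "symmetric_matrix K"
    and ll: "\<And>\<theta> \<theta>'. AE x in model_dist lam f \<theta>'.
           log_likelihood u f \<theta> x = U x + Z x \<bullet> \<theta> - 1 / 2 * (\<theta> \<bullet> (K *v \<theta>))"
  shows "AE x in lam. f (\<theta> + s) x = f \<theta> x * exp (Z x \<bullet> s - s \<bullet> (K *v \<theta>) - (s \<bullet> (K *v s)) / 2)"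
proof -
  have f_measurable [measurable]: "f a \<in> borel_measurable lam" for a
    using model by (simp add: probability_model_def)
  have pos: "AE x in lam. 0 < f a x \<longrightarrow> 0 < f b x" for a b
    using model by (intro AE_model_distD) (simp_all add: probability_model_def)
  from pos[of \<theta> "\<theta> + s"] pos[of "\<theta> + s" \<theta>] AE_model_distD[OF f_measurable ll[of \<theta> \<theta>]]
    AE_model_distD[OF f_measurable ll[of "\<theta> + s" \<theta>]] AE_space
  show ?thesis
  proof eventually_elim
    case (elim x)
    have "0 \<le> f \<theta> x" "0 \<le> f (\<theta> + s) x"
      using model elim by (auto simp: probability_model_def)
    show ?case
    proof (cases "f \<theta> x = 0")
      case True
      then show ?thesis
        using elim \<open>0 \<le> f (\<theta> + s) x\<close> by auto
    next
      case False
      then have pos: "0 < f \<theta> x" "0 < f (\<theta> + s) x"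
        using \<open>0 \<le> f \<theta> x\<close> elim by auto
      then have "ln (f (\<theta> + s) x) = ln (f \<theta> x) + (Z x \<bullet> s - s \<bullet> (K *v \<theta>) - (s \<bullet> (K *v s)) / 2)"
        using elim
        by (simp add: log_likelihood_def quadratic_form_add[OF sym] inner_add_right add_divide_distrib)
      then have "exp (ln (f (\<theta> + s) x)) = exp (ln (f \<theta> x)) * exp (Z x \<bullet> s - s \<bullet> (K *v \<theta>) - (s \<bullet> (K *v s)) / 2)"
        by (simp only: exp_add)
      then show ?thesis
        using pos by simp
    qed
  qed
qed

text \<open>Multiplying \<open>f \<theta>\<close> by \<open>exp (s' Z)\<close> gives a constant multiple of the probability density
  \<open>f (\<theta> + s)\<close>, so the integral is that constant.\<close>

lemma statistic_mgf:
  fixes f :: "real ^ 'p \<Rightarrow> 'a \<Rightarrow> real"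
  assumes model: "probability_model lam f" and sym: "symmetric_matrix K"
    and Z[measurable]: "Z \<in> borel_measurable lam"
    and ll: "\<And>\<theta> \<theta>'. AE x in model_dist lam f \<theta>'.
           log_likelihood u f \<theta> x = U x + Z x \<bullet> \<theta> - 1 / 2 * (\<theta> \<bullet> (K *v \<theta>))"
  shows "(\<integral>\<^sup>+x. exp (s \<bullet> Z x) \<partial>model_dist lam f \<theta>) = exp (s \<bullet> (K *v \<theta>) + (s \<bullet> (K *v s)) / 2)"
proof -
  let ?c = "s \<bullet> (K *v \<theta>) + (s \<bullet> (K *v s)) / 2"
  have [measurable]: "f a \<in> borel_measurable lam" for a
    using model by (simp add: probability_model_def)
  have "prob_space (model_dist lam f (\<theta> + s))"
    using model by (simp add: probability_model_def)
  from prob_space.emeasure_space_1[OF this]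
  have total: "(\<integral>\<^sup>+x. f (\<theta> + s) x \<partial>lam) = 1"
    by (simp add: model_dist_def emeasure_density cong: nn_integral_cong)
  have "(\<integral>\<^sup>+x. exp (s \<bullet> Z x) \<partial>model_dist lam f \<theta>) = (\<integral>\<^sup>+x. f \<theta> x * ennreal (exp (s \<bullet> Z x)) \<partial>lam)"
    by (simp add: model_dist_def nn_integral_density)
  also have "\<dots> = (\<integral>\<^sup>+x. ennreal (exp ?c) * f (\<theta> + s) x \<partial>lam)"
  proof (rule nn_integral_cong_AE)
    show "AE x in lam. f \<theta> x * ennreal (exp (s \<bullet> Z x)) = ennreal (exp ?c) * f (\<theta> + s) x"
      using density_exponential_tilt[OF model sym ll, of \<theta> s] AE_space
    proof eventually_elim
      case (elim x)
      have "0 \<le> f \<theta> x"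
        using model elim by (auto simp: probability_model_def)
      have "exp (s \<bullet> Z x) = exp ?c * exp (Z x \<bullet> s - s \<bullet> (K *v \<theta>) - (s \<bullet> (K *v s)) / 2)"
        by (simp add: inner_commute flip: exp_add)
      then have "f \<theta> x * exp (s \<bullet> Z x) = exp ?c * f (\<theta> + s) x"
        using elim by simp
      then show ?case
        using \<open>0 \<le> f \<theta> x\<close> by (metis ennreal_mult' ennreal_mult'' exp_ge_zero)
    qed
  qed
  also have "\<dots> = exp ?c"
    by (simp add: nn_integral_cmult total)
  finally show ?thesis .
qed

text \<open>The case \<open>s' K s < 0\<close> is excluded by \<open>cosh \<ge> 1\<close>, the case \<open>s' K s = 0\<close> by
  identifiability; both are treated at once by showing that \<open>s' K s \<le> 0\<close> forces \<open>s' Z = 0\<close>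
  almost surely.\<close>

lemma information_positive_definite:
  fixes f :: "real ^ 'p \<Rightarrow> 'a \<Rightarrow> real"
  assumes model: "probability_model lam f" and ident: "identifiable lam f"
    and sym: "symmetric_matrix K" and Z[measurable]: "Z \<in> borel_measurable lam"
    and ll: "\<And>\<theta> \<theta>'. AE x in model_dist lam f \<theta>'.
           log_likelihood u f \<theta> x = U x + Z x \<bullet> \<theta> - 1 / 2 * (\<theta> \<bullet> (K *v \<theta>))"
  shows "positive_definite K"
proof -
  have [measurable]: "f a \<in> borel_measurable lam" for a
    using model by (simp add: probability_model_def)
  have "0 < s \<bullet> (K *v s)" if "s \<noteq> 0" for s
  proof (rule ccontr)
    assume "\<not> 0 < s \<bullet> (K *v s)"
    then have nonpos: "s \<bullet> (K *v s) \<le> 0"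
      by simp
    let ?P = "model_dist lam f 0"
    interpret P: prob_space ?P
      using model by (simp add: probability_model_def)
    have [measurable_cong]: "sets ?P = sets lam"
      by (simp add: model_dist_def)
    note mgf = statistic_mgf[OF model sym Z ll, where \<theta> = 0]
    \<comment> \<open>This is \<open>2 cosh (s' Z) - 2\<close>, which is nonnegative and has mean at most zero.\<close>
    define excess where "excess x = exp (s \<bullet> Z x) + exp (- s \<bullet> Z x) - 2" for x
    have excess: "0 \<le> excess x" "excess x = 0 \<Longrightarrow> s \<bullet> Z x = 0" for x
    proof -
      have sq: "excess x = exp (- s \<bullet> Z x) * (exp (s \<bullet> Z x) - 1)\<^sup>2"
        by (simp add: excess_def power2_eq_square algebra_simps flip: exp_add)
      then show "0 \<le> excess x"
        by simp
      show "s \<bullet> Z x = 0" if "excess x = 0"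
        using that by (simp add: sq)
    qed
    have "(\<integral>\<^sup>+x. ennreal (excess x) \<partial>?P) + 2
        = (\<integral>\<^sup>+x. ennreal (excess x) + 2 \<partial>?P)"
      by (subst nn_integral_add) (simp_all add: P.emeasure_space_1 excess_def)
    also have "\<dots> = (\<integral>\<^sup>+x. ennreal (exp (s \<bullet> Z x)) + ennreal (exp (- s \<bullet> Z x)) \<partial>?P)"
    proof (rule nn_integral_cong)
      fix x
      have "ennreal (excess x) + ennreal 2 = ennreal (exp (s \<bullet> Z x)) + ennreal (exp (- s \<bullet> Z x))"
        using excess(1)[of x] by (subst (1 2) ennreal_plus[symmetric]) (simp_all add: excess_def)
      then show "ennreal (excess x) + 2 = ennreal (exp (s \<bullet> Z x)) + ennreal (exp (- s \<bullet> Z x))"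
        by simp
    qed
    also have "\<dots> = ennreal (exp ((s \<bullet> (K *v s)) / 2)) + ennreal (exp ((s \<bullet> (K *v s)) / 2))"
      using mgf[of s] mgf[of "- s"] by (subst nn_integral_add) (simp_all add: vec.neg)
    also have "\<dots> \<le> ennreal 1 + ennreal 1"
      using nonpos by (intro add_mono ennreal_leI) simp_all
    also have "\<dots> = 2"
      by simp
    finally have "(\<integral>\<^sup>+x. ennreal (excess x) \<partial>?P) = 0"
      using ennreal_add_left_cancel_le[of 2 "\<integral>\<^sup>+x. ennreal (excess x) \<partial>?P" 0]
      by (simp add: add.commute)
    then have "AE x in ?P. ennreal (excess x) = 0"
      by (subst (asm) nn_integral_0_iff_AE) (simp_all add: excess_def)
    then have zero: "AE x in ?P. s \<bullet> Z x = 0"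
      by eventually_elim (metis ennreal_eq_0_iff excess order.antisym)
    have "s \<bullet> (K *v s) = 0"
    proof -
      have "(\<integral>\<^sup>+x. exp (s \<bullet> Z x) \<partial>?P) = (\<integral>\<^sup>+x. 1 \<partial>?P)"
        by (intro nn_integral_cong_AE eventually_mono[OF zero]) simp
      then have "ennreal (exp ((s \<bullet> (K *v s)) / 2)) = 1"
        by (simp add: mgf P.emeasure_space_1)
      then show ?thesis
        by simp
    qed
    have "AE x in lam. 0 < f 0 x \<longrightarrow> s \<bullet> Z x = 0"
      by (rule AE_model_distD[OF _ zero]) measurable
    with density_exponential_tilt[OF model sym ll, of 0 s] AE_space
    have "AE x in lam. ennreal (f s x) = ennreal (f 0 x)"
    proof eventually_elim
      case (elim x)
      then have "0 \<le> f 0 x"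
        using model by (auto simp: probability_model_def)
      with elim \<open>s \<bullet> (K *v s) = 0\<close> show ?case
        by (cases "f 0 x = 0") (auto simp: inner_commute)
    qed
    then have "model_dist lam f s = model_dist lam f 0"
      unfolding model_dist_def by (intro density_cong) simp_all
    then show False
      using ident \<open>s \<noteq> 0\<close> by (auto simp: identifiable_def)
  qed
  then show ?thesis
    using sym by (simp add: positive_definite_def)
qed

theorem corollary3p2:
  fixes lam :: "'a measure"
    and f :: "real ^ 'p \<Rightarrow> 'a \<Rightarrow> real"
    and u U :: "'a \<Rightarrow> real"
    and Z :: "'a \<Rightarrow> real ^ 'p"
    and K :: "real ^ 'p ^ 'p"
  assumes "probability_model lam f"
    and "identifiable lam f"
    and "U \<in> borel_measurable lam"
    and "Z \<in> borel_measurable lam"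
    and "symmetric_matrix K"
    and "\<And>\<theta> \<theta>'. AE x in model_dist lam f \<theta>'.
           log_likelihood u f \<theta> x = U x + Z x \<bullet> \<theta> - 1 / 2 * (\<theta> \<bullet> (K *v \<theta>))"
  shows "positive_definite K \<and>
    (\<forall>\<theta>. is_multivariate_normal (distr (model_dist lam f \<theta>) borel Z) (K *v \<theta>) K)"
proof (intro conjI allI)
  show pd: "positive_definite K"
    using information_positive_definite[OF assms(1,2,5,4,6)] .
  fix \<theta>
  obtain A :: "real ^ 'p ^ 'p" where A: "A ** transpose A = K"
    using positive_definite_factorization[OF pd] .
  have Z: "Z \<in> borel_measurable (model_dist lam f \<theta>)"
    using assms(4) by (simp add: model_dist_def)
  have mgf: "(\<integral>\<^sup>+z. exp (s \<bullet> z) \<partial>distr (model_dist lam f \<theta>) borel Z)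
      = exp (s \<bullet> (K *v \<theta>) + (s \<bullet> (K *v s)) / 2)" for s
    using statistic_mgf[OF assms(1,5,4,6)] by (simp add: nn_integral_distr[OF Z])
  have "distr (model_dist lam f \<theta>) borel Z
      = distr std_multivariate_normal borel (\<lambda>z. K *v \<theta> + A *v z)"
    by (rule measure_eqI_mgf) (simp_all add: mgf multivariate_normal_mgf A)
  then show "is_multivariate_normal (distr (model_dist lam f \<theta>) borel Z) (K *v \<theta>) K"
    using A unfolding is_multivariate_normal_def by blast
qed

end
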